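(* Let $(A_m)_{m\ge 0}$ be a sequence of real numbers such that $\sum_{m\ge 0}\frac{A_m}{m!}x^m$ converges for every real $x$, and put $f(x)=e^{-x}\sum_{m=0}^{\infty}\frac{A_m}{m!}x^m$. Then for all $R>0$ and all integers $n\ge2$, $N\ge0$, \[ \left|A_n-\sum_{m=0}^{N}\frac{f^{(m)}(R)}{m!}R^mC_m(R,n)\right|\le 6\,n!\,\frac{e^R\,E(f^{(N+1)};R)}{R^n}\,n^{N/2}. \]
   Context: $\Delta A_m=A_{m+1}-A_m$, $\Delta^k$ its $k$-fold iterate, and $E(f^{(k)};r)=e^{-r}\sum_{m=0}^\infty\frac{|\Delta^kA_m|}{m!}r^m$. For real $R$ and integers $m,n\ge0$, $R^mC_m(R,n)=\sum_{j=0}^{m}(-1)^{m-j}\binom mj\,n(n-1)\cdots(n-j+1)\,R^{m-j}=n!\,[z^n]\bigl(e^z(z-R)^m\bigr)$ (Charlier polynomials). *)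

theory Defs
  imports "HOL-Analysis.Analysis"
begin

definition fdiff :: "(nat \<Rightarrow> real) \<Rightarrow> nat \<Rightarrow> real" where
  "fdiff A m = A (Suc m) - A m"

definition poisson_transform :: "(nat \<Rightarrow> real) \<Rightarrow> real \<Rightarrow> real" where
  "poisson_transform A x = exp (-x) * (\<Sum>m. A m / fact m * x ^ m)"

text \<open>
  The quantity written \<open>E(f\<^sup>(\<^sup>k\<^sup>); r)\<close>, where \<open>f\<close> is the Poisson transform of \<open>A\<close>. It is a function
  of the coefficient sequence \<open>A\<close>, because the \<open>k\<close>-th derivative of \<open>f\<close> is the Poisson transform of
  the \<open>k\<close>-th difference of \<open>A\<close>.
\<close>

definition E_deriv :: "(nat \<Rightarrow> real) \<Rightarrow> nat \<Rightarrow> real \<Rightarrow> real" where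
  "E_deriv A k r = exp (-r) * (\<Sum>m. \<bar>(fdiff ^^ k) A m\<bar> / fact m * r ^ m)"

text \<open>
  Charlier polynomials, with the empty product giving the falling factorial of order \<open>0\<close>.
  The normalisation \<open>R ^ m * charlier m R n = \<dots>\<close> determines them for \<open>R \<noteq> 0\<close> only;
  for \<open>R = 0\<close> and \<open>m > 0\<close> the value below is the junk value \<open>0\<close>.
\<close>

definition charlier :: "nat \<Rightarrow> real \<Rightarrow> nat \<Rightarrow> real" where
  "charlier m R n =
     (\<Sum>j=0..m. (-1) ^ (m - j) * real (m choose j) * (\<Prod>i<j. real n - real i) * R ^ (m - j)) / R ^ m"

lemma charlier_normalisation:
  assumes "R \<noteq> 0"
  shows "R ^ m * charlier m R n =
     (\<Sum>j=0..m. (-1) ^ (m - j) * real (m choose j) * (\<Prod>i<j. real n - real i) * R ^ (m - j))"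
  using assms by (simp add: charlier_def)

end

theory Submission
  imports Defs
begin

text \<open>
  Write \<open>R\<^sup>m C\<^sub>m(R,n) = m! p\<^sub>m(R)\<close>. Since \<open>p\<^sub>m' = - p\<^bsub>m-1\<^esub>\<close>, the \<open>R\<close>-derivative of
  \<open>G(R) = \<Sum>\<^bsub>m\<le>N\<^esub> f\<^bsup>(m)\<^esup>(R) p\<^sub>m(R)\<close> telescopes to \<open>f\<^bsup>(N+1)\<^esup>(R) p\<^sub>N(R)\<close>, and \<open>G(0)\<close> is the Newton
  forward-difference expansion of \<open>A\<^sub>n\<close>, whose remainder has weights
  \<open>(n-1-m choose N) = \<integral>\<^sub>0\<^sup>\<infinity> e\<^bsup>-w\<^esup> w\<^sup>m/m! p\<^sub>N(w) dw\<close> for \<open>m < n\<close>. Hence in \<open>A\<^sub>n - G(R)\<close> the difference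
  \<open>\<Delta>\<^bsup>N+1\<^esup>A\<^sub>m\<close> is weighted by the integral of \<open>e\<^bsup>-w\<^esup> w\<^sup>m/m! p\<^sub>N(w)\<close> over \<open>[R,\<infinity>)\<close> if \<open>m < n\<close>, and by
  minus its integral over \<open>[0,R]\<close> if \<open>m \<ge> n\<close>. On either range \<open>w\<^sup>m \<le> R\<^bsup>m-n\<^esup> w\<^sup>n\<close>, so everything
  reduces to \<open>\<integral>\<^sub>0\<^sup>\<infinity> e\<^bsup>-w\<^esup> w\<^sup>n/n! \<bar>p\<^sub>N(w)\<bar> dw \<le> 6 n\<^bsup>N/2\<^esup>\<close>. This integral is symmetric in \<open>n\<close> and \<open>N\<close>,
  and the corresponding integral of \<open>p\<^sub>N\<^sup>2\<close> is \<open>\<Sum>\<^sub>k (N choose k)\<^sup>2 (n+k choose k)\<close>. The bound for the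
  square thus has to be checked with the smaller of \<open>n\<close>, \<open>N\<close> in the role of \<open>N\<close>; from the diagonal,
  where the sum is at most \<open>(2k choose k)\<^sup>2\<close>, it follows by induction.
\<close>

subsection \<open>Binomial sums\<close>

text \<open>For i <= k the factor \<open>(k + i) choose i\<close> equals
  \<open>(k + i) choose k\<close>, which is largest at i = k; the remaining squares add up to
  \<open>(2 * k) choose k\<close>.\<close>

lemma sum_choose_square_mult_choose_diag_le:
  "(\<Sum>i\<le>k. (k choose i)\<^sup>2 * ((k + i) choose i)) \<le> ((2 * k) choose k)\<^sup>2"
proof -
  have "(\<Sum>i\<le>k. (k choose i)\<^sup>2 * ((k + i) choose i)) \<le> (\<Sum>i\<le>k. (k choose i)\<^sup>2 * ((2 * k) choose k))"
  proof (intro sum_mono mult_left_mono)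
    fix i assume "i \<in> {..k}"
    then have "(k + i) choose i = (k + i) choose k" "k + i \<le> 2 * k"
      using binomial_symmetric[of i "k + i"] by auto
    then show "(k + i) choose i \<le> (2 * k) choose k"
      using binomial_right_mono by metis
  qed simp
  also have "\<dots> = ((2 * k) choose k)\<^sup>2"
    by (simp only: sum_distrib_right[symmetric] choose_square_sum) (simp add: power2_eq_square)
  finally show ?thesis .
qed

text \<open>Consecutive central binomial coefficients have ratio 2(2k+1)/(k+1), which is below
  4.\<close>

lemma central_binomial_square_Suc_le:
  "((2 * Suc k) choose Suc k)\<^sup>2 \<le> 16 * ((2 * k) choose k)\<^sup>2"
proof -
  have "Suc k * ((2 * Suc k) choose Suc k) = 2 * (2 * k + 1) * ((2 * k) choose k)"
  proof -
    have "(2 * k + 1) choose Suc k = (2 * k + 1) choose k"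
      using binomial_symmetric[of k "2 * k + 1"] by (simp del: binomial_Suc_Suc)
    then have "(2 * Suc k) choose Suc k = 2 * ((2 * k + 1) choose Suc k)"
      by simp
    moreover have "Suc k * ((2 * k + 1) choose Suc k) = (2 * k + 1) * ((2 * k) choose k)"
      using Suc_times_binomial[of k "2 * k"] by (simp del: binomial_Suc_Suc)
    ultimately show ?thesis by (metis mult.assoc mult.left_commute)
  qed
  also have "\<dots> \<le> Suc k * (4 * ((2 * k) choose k))"
    by (simp add: algebra_simps)
  finally have "(2 * Suc k) choose Suc k \<le> 4 * ((2 * k) choose k)"
    by (simp only: Suc_mult_le_cancel1)
  then have "((2 * Suc k) choose Suc k)\<^sup>2 \<le> (4 * ((2 * k) choose k))\<^sup>2"
    by (rule power_mono) simp
  then show ?thesis by (simp add: power_mult_distrib)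
qed

text \<open>Bernoulli's inequality for (1 + 1/l)^k with denominators cleared. It controls how the
  bound l^k grows when l increases by one.\<close>

lemma Suc_power_ge:
  assumes "k \<le> l"
  shows "(l + k) * l ^ k \<le> l * Suc l ^ k"
proof (cases "l = 0")
  case False
  have "1 + real k * (1 / l) \<le> (1 + 1 / l) ^ k"
    by (rule Bernoulli_inequality) (rule order_trans[of _ 0], simp_all)
  then have "(1 + real k * (1 / l)) * (l * l ^ k) \<le> (1 + 1 / l) ^ k * (l * l ^ k)"
    by (rule mult_right_mono) simp
  also have "\<dots> = l * ((1 + 1 / l) * l) ^ k"
    by (simp add: power_mult_distrib)
  also have "(1 + 1 / l) * l = real (Suc l)"
    using False by (simp add: field_simps)
  also have "(1 + real k * (1 / l)) * (l * l ^ k) = real ((l + k) * l ^ k)"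
    using False by (simp add: field_simps)
  finally have "real ((l + k) * l ^ k) \<le> real (l * Suc l ^ k)"
    by simp
  then show ?thesis by (simp only: of_nat_le_iff)
qed (use assms in auto)

text \<open>36 is the square of the final constant 6. From k to k+1 the left side grows at most
  16-fold and the right side by (k+1)^(k+1)/k^k >= 2(k+1), which is at least 16 once k >= 7; the
  cases up to 7 are computed.\<close>

lemma central_binomial_square_le: "((2 * k) choose k)\<^sup>2 \<le> 36 * k ^ k"
proof (cases "k \<le> 7")
  case True
  then have "k \<in> {0, 1, 2, 3, 4, 5, 6, 7}" by auto
  then show ?thesis
    by (auto simp: binomial_fact' fact_numeral)
next
  case False
  then have "7 \<le> k" by simp
  then show ?thesis
  proof (induction k rule: dec_induct)
    case base
    show ?case by (simp add: binomial_fact' fact_numeral)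
  next
    case (step k)
    have "k * (2 * k ^ k) \<le> k * Suc k ^ k"
      using Suc_power_ge[of k k, OF order_refl] by (simp only: mult_2 distrib_left distrib_right)
    then have *: "2 * k ^ k \<le> Suc k ^ k"
      by (rule nat_mult_le_cancel1[THEN iffD1, rotated]) (use step.hyps in simp)
    have "((2 * Suc k) choose Suc k)\<^sup>2 \<le> 16 * (36 * k ^ k)"
      using central_binomial_square_Suc_le[of k] step.IH by linarith
    also have "\<dots> \<le> 36 * (8 * Suc k ^ k)"
      using * by simp
    also have "\<dots> \<le> 36 * Suc k ^ Suc k"
      using step.hyps by simp
    finally show ?case .
  qed
qed

lemma choose_Suc_add: "Suc l * ((Suc l + i) choose i) = (Suc l + i) * ((l + i) choose i)"
  using Suc_times_binomial[of l "l + i"] binomial_symmetric[of i "l + i"]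
    binomial_symmetric[of i "Suc l + i"]
  by (simp del: binomial_Suc_Suc) 

text \<open>For l > 0, passing from l to l+1 multiplies the i-th binomial by 1 + i/(l+1), at most 1
  + k/l, and by \<open>Suc_power_ge\<close> the right side grows at least as much.\<close>

lemma sum_choose_square_mult_choose_le:
  assumes "k \<le> l"
  shows "(\<Sum>i\<le>k. (k choose i)\<^sup>2 * ((l + i) choose i)) \<le> 36 * l ^ k"
  using assms
proof (induction l rule: dec_induct)
  case base
  show ?case
    using sum_choose_square_mult_choose_diag_le central_binomial_square_le by (rule order_trans)
next
  case (step l)
  show ?case
  proof (cases "l = 0")
    case False
    have *: "l * ((Suc l + i) choose i) \<le> (l + k) * ((l + i) choose i)" if "i \<le> k" for i
    proof -
      have "Suc l * (l * ((Suc l + i) choose i)) = (l * (Suc l + i)) * ((l + i) choose i)"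
        using choose_Suc_add[of l i] by (metis mult.assoc mult.left_commute)
      also have "\<dots> \<le> (Suc l * (l + k)) * ((l + i) choose i)"
      proof (rule mult_right_mono)
        have "l * i \<le> l * k" using that by (rule mult_le_mono2)
        then have "l * i \<le> l * k + k" by linarith
        moreover have "Suc l * (l + k) = l * Suc l + (l * k + k)"
            by (simp add: algebra_simps)
          ultimately show "l * (Suc l + i) \<le> Suc l * (l + k)"
            by (simp only: distrib_left add.assoc add_le_cancel_left)
      qed simp
      finally have "Suc l * (l * ((Suc l + i) choose i)) \<le> Suc l * ((l + k) * ((l + i) choose i))"
        by (simp only: mult.assoc)
      then show ?thesis by (simp only: Suc_mult_le_cancel1)
    qed
    have "l * (\<Sum>i\<le>k. (k choose i)\<^sup>2 * ((Suc l + i) choose i))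
        = (\<Sum>i\<le>k. (k choose i)\<^sup>2 * (l * ((Suc l + i) choose i)))"
      unfolding sum_distrib_left by (simp only: mult.left_commute)
    also have "\<dots> \<le> (\<Sum>i\<le>k. (k choose i)\<^sup>2 * ((l + k) * ((l + i) choose i)))"
      using * by (intro sum_mono mult_left_mono) auto
    also have "\<dots> = (l + k) * (\<Sum>i\<le>k. (k choose i)\<^sup>2 * ((l + i) choose i))"
      unfolding sum_distrib_left by (simp only: mult.left_commute)
    also have "\<dots> \<le> (l + k) * (36 * l ^ k)"
      using step.IH by (rule mult_left_mono) simp
    also have "\<dots> \<le> l * (36 * Suc l ^ k)"
      using Suc_power_ge[OF step.hyps(1)] by simp
    finally show ?thesis using False by simp
  qed (use step in auto)
qed

text \<open>Now the exponent varies: each step in N multiplies the right side by n, and the i-th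
  binomial by 1 + i/(N+1) <= 2 <= n, because i <= n <= N.\<close>

lemma sum_choose_square_mult_choose_le_swapped:
  assumes "2 \<le> n" "n \<le> N"
  shows "(\<Sum>i\<le>n. (n choose i)\<^sup>2 * ((N + i) choose i)) \<le> 36 * n ^ N"
  using assms(2)
proof (induction N rule: dec_induct)
  case base
  show ?case using sum_choose_square_mult_choose_le by blast
next
  case (step N)
  have *: "(Suc N + i) choose i \<le> n * ((N + i) choose i)" if "i \<le> n" for i
  proof -
    have "Suc N * ((Suc N + i) choose i) = (Suc N + i) * ((N + i) choose i)"
      by (rule choose_Suc_add)
    also have "\<dots> \<le> (Suc N * 2) * ((N + i) choose i)"
      using that step.hyps by (intro mult_right_mono) auto
    also have "\<dots> \<le> (Suc N * n) * ((N + i) choose i)"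
      using assms(1) by (intro mult_right_mono mult_left_mono) auto
    finally have "Suc N * ((Suc N + i) choose i) \<le> Suc N * (n * ((N + i) choose i))"
      by (simp only: mult.assoc)
    then show ?thesis by (simp only: Suc_mult_le_cancel1)
  qed
  have "(\<Sum>i\<le>n. (n choose i)\<^sup>2 * ((Suc N + i) choose i))
      \<le> (\<Sum>i\<le>n. (n choose i)\<^sup>2 * (n * ((N + i) choose i)))"
    using * by (intro sum_mono mult_left_mono) auto
  also have "\<dots> = n * (\<Sum>i\<le>n. (n choose i)\<^sup>2 * ((N + i) choose i))"
    unfolding sum_distrib_left by (simp only: mult.left_commute)
  also have "\<dots> \<le> n * (36 * n ^ N)"
    using step.IH by (rule mult_left_mono) simp
  finally show ?case by simp
qed

section \<open>Alternating sums evaluated by Vandermonde's identity\<close>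

text \<open>The sign turns (b+j choose j) into the generalised coefficient of -(b+1) over j, so the
  sum is a Vandermonde convolution.\<close>

lemma sum_alternating_choose_mult:
  "(\<Sum>j\<le>M. (-1) ^ j * real (n choose (M - j)) * real ((b + j) choose j))
     = (real n - real b - 1) gchoose M"
proof -
  have "(\<Sum>j\<le>M. (-1) ^ j * real (n choose (M - j)) * real ((b + j) choose j))
      = (\<Sum>j=0..M. ((- (real b + 1)) gchoose j) * (real n gchoose (M - j)))"
    unfolding gbinomial_minus atLeast0AtMost
    by (rule sum.cong) (simp_all add: binomial_gbinomial)
  also have "\<dots> = (- (real b + 1) + real n) gchoose M"
    by (rule gbinomial_Vandermonde)
  also have "- (real b + 1) + real n = real n - real b - 1" by simp
  finally show ?thesis .
qed

lemma gbinomial_neg_Suc: "(- real k - 1) gchoose M = (-1) ^ M * real ((k + M) choose M)"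
proof -
  have "- real k - 1 = - (real k + 1)" "real k + 1 + real M - 1 = real (k + M)"
    by simp_all
  then show ?thesis
    by (simp only: gbinomial_minus binomial_gbinomial)
qed

lemma sum_alternating_choose_mult_add:
  "(\<Sum>j\<le>M. (-1) ^ j * real (n choose (M - j)) * real ((n + k + j) choose j))
     = (-1) ^ M * real ((k + M) choose M)"
  unfolding sum_alternating_choose_mult gbinomial_neg_Suc[symmetric] by simp

text \<open>The left side is what integrating the squared polynomial term by term produces; the
  right side has nonnegative terms and can be bounded. Expanding \<open>(i + N) choose N\<close> by
  Vandermonde and exchanging sums reduces the inner sum to
  \<open>sum_alternating_choose_mult_add\<close>.\<close>

lemma sum_alternating_choose_choose:
  "(\<Sum>i\<le>N. (-1) ^ i * real (n choose (N - i)) * real ((n + i) choose i) * ((-1) ^ N * real ((i + N) choose N)))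
     = (\<Sum>k\<le>N. (real (N choose k))\<^sup>2 * real ((n + k) choose k))"
proof -
  have expand: "real ((i + N) choose N) = (\<Sum>k\<le>N. real (N choose k) * real (i choose k))" for i
  proof -
    have "(i + N) choose N = (\<Sum>k\<le>N. (i choose k) * (N choose (N - k)))"
      by (simp add: vandermonde)
    also have "\<dots> = (\<Sum>k\<le>N. (N choose k) * (i choose k))"
      by (rule sum.cong) (simp_all add: binomial_symmetric[symmetric])
    finally show ?thesis by simp
  qed
  have inner: "(\<Sum>i\<le>N. (-1) ^ i * real (n choose (N - i)) * real ((n + i) choose i) * real (i choose k))
      = real ((n + k) choose k) * ((-1) ^ N * real (N choose k))" if "k \<le> N" for k
  proof -
    have "(\<Sum>i\<le>N. (-1) ^ i * real (n choose (N - i)) * real ((n + i) choose i) * real (i choose k))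
      = (\<Sum>i\<in>{k..N}. (-1) ^ i * real (n choose (N - i)) * real ((n + i) choose i) * real (i choose k))"
      by (rule sum.mono_neutral_right) (auto simp: binomial_eq_0)
    also have "\<dots> = (\<Sum>j\<le>N - k. (-1) ^ (k + j) * real (n choose (N - (k + j)))
        * real ((n + (k + j)) choose (k + j)) * real ((k + j) choose k))"
      by (rule sum.reindex_bij_witness[of _ "\<lambda>j. k + j" "\<lambda>i. i - k"]) (use that in auto)
    also have "\<dots> = (\<Sum>j\<le>N - k. real ((n + k) choose k) * (-1) ^ k *
        ((-1) ^ j * real (n choose (N - k - j)) * real ((n + k + j) choose j)))"
    proof (rule sum.cong)
      fix j
      \<comment> \<open>Both products are the multinomial coefficient (n+k+j)! / (n! k! j!).\<close>
      have "real ((n + (k + j)) choose (k + j)) * real ((k + j) choose k)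
          = real ((n + k) choose k) * real ((n + k + j) choose j)"
        by (simp add: binomial_fact field_simps)
      then show "(-1) ^ (k + j) * real (n choose (N - (k + j)))
        * real ((n + (k + j)) choose (k + j)) * real ((k + j) choose k) = real ((n + k) choose k) * (-1) ^ k *
        ((-1) ^ j * real (n choose (N - k - j)) * real ((n + k + j) choose j))"
        by (simp add: power_add mult_ac)
    qed simp
    also have "\<dots> = real ((n + k) choose k) * (-1) ^ k * ((-1) ^ (N - k) * real ((k + (N - k)) choose (N - k)))"
      unfolding sum_distrib_left[symmetric] sum_alternating_choose_mult_add ..
    also have "\<dots> = real ((n + k) choose k) * ((-1) ^ N * real (N choose k))"
      using that by (simp add: power_add[symmetric] binomial_symmetric[symmetric])
    finally show ?thesis .
  qed
  have "(\<Sum>i\<le>N. (-1) ^ i * real (n choose (N - i)) * real ((n + i) choose i) * ((-1) ^ N * real ((i + N) choose N)))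
      = (\<Sum>i\<le>N. \<Sum>k\<le>N. (-1) ^ N * real (N choose k) *
          ((-1) ^ i * real (n choose (N - i)) * real ((n + i) choose i) * real (i choose k)))"
    unfolding expand sum_distrib_left by (intro sum.cong) (simp_all add: mult_ac)
  also have "\<dots> = (\<Sum>k\<le>N. (-1) ^ N * real (N choose k) *
      (\<Sum>i\<le>N. (-1) ^ i * real (n choose (N - i)) * real ((n + i) choose i) * real (i choose k)))"
    by (subst sum.swap) (simp only: sum_distrib_left)
  also have "\<dots> = (\<Sum>k\<le>N. (real (N choose k))\<^sup>2 * real ((n + k) choose k))"
  proof (intro sum.cong refl)
    fix k assume "k \<in> {..N}"
    then have "k \<le> N" by simp
    show "(-1) ^ N * real (N choose k) *
      (\<Sum>i\<le>N. (-1) ^ i * real (n choose (N - i)) * real ((n + i) choose i) * real (i choose k))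
      = (real (N choose k))\<^sup>2 * real ((n + k) choose k)"
      unfolding inner[OF \<open>k \<le> N\<close>]
      by (simp add: power2_eq_square mult_ac flip: power_mult_distrib)
  qed
  finally show ?thesis .
qed

subsection \<open>Charlier polynomials as functions of the parameter\<close>

text \<open>
  In terms of generalised Laguerre polynomials, \<open>charlier_poly n m\<close> is \<open>L\<^sub>m\<^bsup>(n-m)\<^esup>\<close>.
\<close>

definition charlier_poly :: "nat \<Rightarrow> nat \<Rightarrow> real \<Rightarrow> real" where
  "charlier_poly n m w = (\<Sum>i\<le>m. (-1) ^ i * real (n choose (m - i)) * w ^ i / fact i)"

lemma falling_factorial_eq: "(\<Prod>i<j. real n - real i) = fact j * real (n choose j)"
  by (simp add: binomial_gbinomial gbinomial_prod_rev atLeast0LessThan)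

lemma charlier_poly_altdef:
  "charlier_poly n m w = (\<Sum>j\<le>m. (-1) ^ (m - j) * real (n choose j) * w ^ (m - j) / fact (m - j))"
  unfolding charlier_poly_def
  by (rule sum.reindex_bij_witness[of _ "\<lambda>i. m - i" "\<lambda>i. m - i"]) auto

lemma charlier_conv_charlier_poly:
  assumes "R > 0"
  shows "1 / fact m * R ^ m * charlier m R n = charlier_poly n m R"
proof -
  have "R ^ m * charlier m R n = fact m * charlier_poly n m R"
    unfolding charlier_normalisation[OF less_imp_neq[OF assms, symmetric]] charlier_poly_altdef
      falling_factorial_eq sum_distrib_left atLeast0AtMost
    by (rule sum.cong) (simp_all add: binomial_fact)
  then show ?thesis by (simp add: field_simps)
qed

lemma charlier_poly_0 [simp]: "charlier_poly n m 0 = real (n choose m)"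
  unfolding charlier_poly_def sum.atMost_shift by simp

lemma has_real_derivative_charlier_poly_Suc:
  "(charlier_poly n (Suc m) has_real_derivative - charlier_poly n m w) (at w)"
proof -
  have "((\<lambda>w. \<Sum>i\<le>Suc m. (-1) ^ i * real (n choose (Suc m - i)) * w ^ i / fact i) has_real_derivative
     (\<Sum>i\<le>Suc m. (-1) ^ i * real (n choose (Suc m - i)) * (real i * w ^ (i - 1)) / fact i)) (at w)"
    by (rule DERIV_sum) (auto intro!: derivative_eq_intros)
  also have "(\<Sum>i\<le>Suc m. (-1) ^ i * real (n choose (Suc m - i)) * (real i * w ^ (i - 1)) / fact i)
     = - charlier_poly n m w"
    unfolding charlier_poly_def sum.atMost_Suc_shift sum_negf[symmetric]
    by (auto intro!: sum.cong simp: field_simps simp del: of_nat_Suc)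
  finally show ?thesis
    unfolding charlier_poly_def[abs_def] .
qed

text \<open>The terms with j > n drop out, and then (n choose j) / (n! (N-j)!) = 1 / (j! (n-j)!
  (N-j)!) is symmetric in n and N, so only a sign changes. This duality lets n and N be exchanged in
  the integral estimate.\<close>

lemma charlier_poly_swap:
  assumes "n < N"
  shows "w ^ n / fact n * charlier_poly n N w = (-1) ^ (N - n) * (w ^ N / fact N * charlier_poly N n w)"
proof -
  have "charlier_poly n N w
      = (\<Sum>j\<le>n. (-1) ^ (N - j) * real (n choose j) * w ^ (N - j) / fact (N - j))"
    unfolding charlier_poly_altdef using assms
    by (intro sum.mono_neutral_right) (auto simp: binomial_eq_0)
  then have "w ^ n / fact n * charlier_poly n N w
      = (\<Sum>j\<le>n. w ^ n / fact n * ((-1) ^ (N - j) * real (n choose j) * w ^ (N - j) / fact (N - j)))"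
    by (simp add: sum_distrib_left)
  also have "\<dots> = (\<Sum>j\<le>n. (-1) ^ (N - n) * (w ^ N / fact N *
      ((-1) ^ (n - j) * real (N choose j) * w ^ (n - j) / fact (n - j))))"
  proof (rule sum.cong)
    fix j assume "j \<in> {..n}"
    then have j: "j \<le> n" "j \<le> N" using assms by auto
    have "(-1) ^ (N - j) = ((-1) ^ (N - n) * (-1) ^ (n - j) :: real)"
      "w ^ n * w ^ (N - j) = w ^ N * w ^ (n - j)"
      using j assms by (simp_all add: power_add[symmetric] add.commute)
    then show "w ^ n / fact n * ((-1) ^ (N - j) * real (n choose j) * w ^ (N - j) / fact (N - j))
      = (-1) ^ (N - n) * (w ^ N / fact N *
         ((-1) ^ (n - j) * real (N choose j) * w ^ (n - j) / fact (n - j)))"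
      using j by (simp add: binomial_fact field_simps)
  qed simp
  also have "\<dots> = (-1) ^ (N - n) * (w ^ N / fact N * charlier_poly N n w)"
    by (simp add: sum_distrib_left charlier_poly_altdef)
  finally show ?thesis .
qed

subsection \<open>Integrals against the gamma density\<close>

lemma has_integral_power_mult_exp:
  "((\<lambda>w::real. w ^ k * exp (-w)) has_integral fact k) {0..}"
proof -
  have "((\<lambda>t. t powr (real (Suc k) - 1) / exp t) has_integral Gamma (real (Suc k))) {0..}"
    by (rule Gamma_integral_real) simp
  then have "((\<lambda>t. t powr real k / exp t) has_integral fact k) {0..}"
    by (simp add: Gamma_fact[symmetric] add.commute)
  \<comment> \<open>\<open>0 powr 0\<close> is 0 whereas \<open>0 ^ 0\<close> is 1, so for k = 0 the
    integrands differ at the origin; changing one point does not affect the integral.\<close>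
  then show ?thesis
    by (rule has_integral_spike[of "{0}", rotated 2])
      (auto simp: powr_realpow exp_minus field_simps)
qed

text \<open>The generalised coefficient serves two ranges: q < n gives the Newton weight (n-1-q
  choose m), and q >= n gives (-1)^m (q-n+m choose m), which enters the integral of the
  square.\<close>

lemma has_integral_moment_charlier_poly:
  "((\<lambda>w. w ^ q * exp (-w) * charlier_poly n m w) has_integral
      fact q * ((real n - real q - 1) gchoose m)) {0..}"
proof -
  have "((\<lambda>w::real. \<Sum>i\<le>m. ((-1) ^ i * real (n choose (m - i)) / fact i) * (w ^ (q + i) * exp (-w)))
     has_integral (\<Sum>i\<le>m. ((-1) ^ i * real (n choose (m - i)) / fact i) * fact (q + i))) {0..}"
    by (intro has_integral_sum has_integral_mult_right has_integral_power_mult_exp) auto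
  also have "(\<Sum>i\<le>m. ((-1) ^ i * real (n choose (m - i)) / fact i) * fact (q + i))
     = fact q * (\<Sum>i\<le>m. (-1) ^ i * real (n choose (m - i)) * real ((q + i) choose i))"
    unfolding sum_distrib_left by (rule sum.cong) (simp_all add: binomial_fact)
  also have "\<dots> = fact q * ((real n - real q - 1) gchoose m)"
    unfolding sum_alternating_choose_mult ..
  also have "(\<lambda>w::real. \<Sum>i\<le>m. ((-1) ^ i * real (n choose (m - i)) / fact i) * (w ^ (q + i) * exp (-w)))
     = (\<lambda>w. w ^ q * exp (-w) * charlier_poly n m w)"
    by (simp add: charlier_poly_def sum_distrib_left power_add mult_ac)
  finally show ?thesis .
qed

text \<open>Only one of the two factors is expanded; each of its monomials then meets a known moment
  of the other factor.\<close>

lemma has_integral_charlier_poly_square: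
  "((\<lambda>w. w ^ n * exp (-w) * (charlier_poly n N w)\<^sup>2) has_integral
      fact n * (\<Sum>k\<le>N. (real (N choose k))\<^sup>2 * real ((n + k) choose k))) {0..}"
proof -
  have "((\<lambda>w::real. \<Sum>i\<le>N. ((-1) ^ i * real (n choose (N - i)) / fact i) *
      (w ^ (n + i) * exp (-w) * charlier_poly n N w)) has_integral
      (\<Sum>i\<le>N. ((-1) ^ i * real (n choose (N - i)) / fact i) *
        (fact (n + i) * ((real n - real (n + i) - 1) gchoose N)))) {0..}"
    by (intro has_integral_sum has_integral_mult_right has_integral_moment_charlier_poly) auto
  also have "(\<Sum>i\<le>N. ((-1) ^ i * real (n choose (N - i)) / fact i) *
        (fact (n + i) * ((real n - real (n + i) - 1) gchoose N)))
    = fact n * (\<Sum>i\<le>N. (-1) ^ i * real (n choose (N - i)) * real ((n + i) choose i) * ((-1) ^ N * real ((i + N) choose N)))"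
    unfolding sum_distrib_left
  proof (rule sum.cong)
    fix i
    have "(real n - real (n + i) - 1) gchoose N = (-1) ^ N * real ((i + N) choose N)"
      unfolding gbinomial_neg_Suc[symmetric] by simp
    then show "((-1) ^ i * real (n choose (N - i)) / fact i) *
        (fact (n + i) * ((real n - real (n + i) - 1) gchoose N))
      = fact n * ((-1) ^ i * real (n choose (N - i)) * real ((n + i) choose i) * ((-1) ^ N * real ((i + N) choose N)))"
      by (simp add: binomial_fact[of i "n + i"])
  qed simp
  also have "(\<lambda>w::real. \<Sum>i\<le>N. ((-1) ^ i * real (n choose (N - i)) / fact i) *
      (w ^ (n + i) * exp (-w) * charlier_poly n N w))
     = (\<lambda>w. w ^ n * exp (-w) * (charlier_poly n N w)\<^sup>2)"
  proof
    fix w :: real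
    have "w ^ n * exp (-w) * (charlier_poly n N w)\<^sup>2
        = charlier_poly n N w * (w ^ n * exp (-w) * charlier_poly n N w)"
      by (simp add: power2_eq_square mult_ac)
    also have "\<dots> = (\<Sum>i\<le>N. ((-1) ^ i * real (n choose (N - i)) / fact i) *
      (w ^ (n + i) * exp (-w) * charlier_poly n N w))"
      by (subst (1) charlier_poly_def)
        (simp add: sum_distrib_right sum_distrib_left power_add mult_ac)
    finally show "(\<Sum>i\<le>N. ((-1) ^ i * real (n choose (N - i)) / fact i) *
      (w ^ (n + i) * exp (-w) * charlier_poly n N w))
     = w ^ n * exp (-w) * (charlier_poly n N w)\<^sup>2" ..
  qed
  finally show ?thesis unfolding sum_alternating_choose_choose .
qed

text \<open>Absolute integrability will pass to the absolute value and to the pieces [0,R] and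
  [R,infinity). Each monomial times exp(-w) is nonnegative on the half-line, so for these it follows
  from integrability.\<close>

lemma absolutely_integrable_moment_charlier_poly:
  "(\<lambda>w. w ^ q * exp (-w) * charlier_poly n m w) absolutely_integrable_on {0..}"
proof -
  have "(\<lambda>w::real. w ^ k * exp (-w)) absolutely_integrable_on {0..}" for k
    using has_integral_power_mult_exp[of k]
    by (intro nonnegative_absolutely_integrable_1) auto
  then have "(\<lambda>w::real. \<Sum>i\<le>m. ((-1) ^ i * real (n choose (m - i)) / fact i) * (w ^ (q + i) * exp (-w)))
      absolutely_integrable_on {0..}"
    by (intro absolutely_integrable_sum set_integrable_mult_right) auto
  then show ?thesis
    by (simp add: charlier_poly_def sum_distrib_left power_add mult_ac)
qed

lemma absolutely_integrable_moment_abs_charlier_poly: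
  "(\<lambda>w. w ^ q * exp (-w) * \<bar>charlier_poly n m w\<bar>) absolutely_integrable_on {0..}"
proof -
  have "(\<lambda>w. \<bar>w ^ q * exp (-w) * charlier_poly n m w\<bar>) absolutely_integrable_on {0..}"
    using set_integrable_abs[OF absolutely_integrable_moment_charlier_poly] .
  then show ?thesis
    by (rule set_integrable_cong[THEN iffD1, rotated -1]) (auto simp: abs_mult)
qed

text \<open>In place of Cauchy-Schwarz, the pointwise bound |p| <= p^2/(2c) + c/2, that is (|p| -
  c)^2 >= 0, is integrated against w^n exp(-w), whose mass is n!. Each of the two terms contributes
  at most n! c/2.\<close>

lemma integral_abs_charlier_poly_le_of_square:
  assumes "c > 0" and "(\<Sum>k\<le>N. (real (N choose k))\<^sup>2 * real ((n + k) choose k)) \<le> c\<^sup>2"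
  shows "integral {0..} (\<lambda>w. w ^ n * exp (-w) * \<bar>charlier_poly n N w\<bar>) \<le> fact n * c"
proof -
  define S where "S = (\<Sum>k\<le>N. (real (N choose k))\<^sup>2 * real ((n + k) choose k))"
  have "((\<lambda>w. (1 / (2 * c)) * (w ^ n * exp (-w) * (charlier_poly n N w)\<^sup>2) + (c / 2) * (w ^ n * exp (-w)))
      has_integral (1 / (2 * c)) * (fact n * S) + (c / 2) * fact n) {0..}"
    unfolding S_def
    by (intro has_integral_add has_integral_mult_right has_integral_charlier_poly_square
        has_integral_power_mult_exp)
  then have "integral {0..} (\<lambda>w. w ^ n * exp (-w) * \<bar>charlier_poly n N w\<bar>)
      \<le> (1 / (2 * c)) * (fact n * S) + (c / 2) * fact n"
  proof (rule has_integral_le[OF integrable_integral, rotated])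
    show "(\<lambda>w. w ^ n * exp (-w) * \<bar>charlier_poly n N w\<bar>) integrable_on {0..}"
      using absolutely_integrable_moment_abs_charlier_poly by (rule set_lebesgue_integral_eq_integral)
    fix w :: real assume w: "w \<in> {0..}"
    have "0 \<le> (\<bar>charlier_poly n N w\<bar> - c)\<^sup>2" by simp
    then have "\<bar>charlier_poly n N w\<bar> \<le> (1 / (2 * c)) * (charlier_poly n N w)\<^sup>2 + c / 2"
      using assms(1) by (simp add: power2_diff field_simps power2_eq_square)
    from mult_left_mono[OF this, of "w ^ n * exp (-w)"]
    show "w ^ n * exp (-w) * \<bar>charlier_poly n N w\<bar>
      \<le> (1 / (2 * c)) * (w ^ n * exp (-w) * (charlier_poly n N w)\<^sup>2) + (c / 2) * (w ^ n * exp (-w))"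
      using w by (simp add: algebra_simps)
  qed
  also have "\<dots> \<le> (1 / (2 * c)) * (fact n * c\<^sup>2) + (c / 2) * fact n"
    using assms unfolding S_def by (intro add_mono mult_left_mono) auto
  also have "\<dots> = fact n * c"
    using assms(1) by (simp add: field_simps power2_eq_square)
  finally show ?thesis .
qed

lemma integral_abs_charlier_poly_le:
  assumes "2 \<le> n"
  shows "integral {0..} (\<lambda>w. w ^ n * exp (-w) * \<bar>charlier_poly n N w\<bar>)
     \<le> fact n * (6 * real n powr (real N / 2))"
proof -
  define c where "c = 6 * real n powr (real N / 2)"
  have "c > 0" using assms by (simp add: c_def)
  have "(real n powr (real N / 2))\<^sup>2 = real n ^ N"
    using assms by (simp add: power2_eq_square powr_add[symmetric] powr_realpow)
  then have c2: "c\<^sup>2 = real (36 * n ^ N)"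
    by (simp add: c_def power_mult_distrib)
  show ?thesis
  proof (cases "N \<le> n")
    case True
    have "real (\<Sum>k\<le>N. (N choose k)\<^sup>2 * ((n + k) choose k)) \<le> c\<^sup>2"
      unfolding c2 of_nat_le_iff by (rule sum_choose_square_mult_choose_le[OF True])
    then show ?thesis
      using integral_abs_charlier_poly_le_of_square[OF \<open>c > 0\<close>, of N n] by (simp add: c_def)
  next
    case False
    \<comment> \<open>By \<open>charlier_poly_swap\<close> the integrand is
      \<open>fact n / fact N\<close> times the one with n and N exchanged, and this factor turns the
      exchanged bound \<open>fact N * c\<close> into \<open>fact n * c\<close>.\<close>
    then have "n < N" by simp
    have "real (\<Sum>k\<le>n. (n choose k)\<^sup>2 * ((N + k) choose k)) \<le> c\<^sup>2"
      unfolding c2 of_nat_le_iff using assms False by (intro sum_choose_square_mult_choose_le_swapped) auto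
    then have le: "integral {0..} (\<lambda>w. w ^ N * exp (-w) * \<bar>charlier_poly N n w\<bar>) \<le> fact N * c"
      using integral_abs_charlier_poly_le_of_square[OF \<open>c > 0\<close>, of n N] by simp
    have "integral {0..} (\<lambda>w. w ^ n * exp (-w) * \<bar>charlier_poly n N w\<bar>)
        = integral {0..} (\<lambda>w. fact n / fact N * (w ^ N * exp (-w) * \<bar>charlier_poly N n w\<bar>))"
    proof (rule integral_cong)
      fix w :: real assume w: "w \<in> {0..}"
      have "\<bar>w ^ n / fact n * charlier_poly n N w\<bar> = \<bar>w ^ N / fact N * charlier_poly N n w\<bar>"
        unfolding charlier_poly_swap[OF \<open>n < N\<close>] by (simp add: abs_mult)
      then have "w ^ n * \<bar>charlier_poly n N w\<bar> = fact n / fact N * (w ^ N * \<bar>charlier_poly N n w\<bar>)"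
        using w by (simp add: abs_mult field_simps)
      from arg_cong[OF this, of "\<lambda>x. exp (-w) * x"] show "w ^ n * exp (-w) * \<bar>charlier_poly n N w\<bar>
          = fact n / fact N * (w ^ N * exp (-w) * \<bar>charlier_poly N n w\<bar>)"
        by (simp add: mult_ac)
    qed
    also have "\<dots> = fact n / fact N * integral {0..} (\<lambda>w. w ^ N * exp (-w) * \<bar>charlier_poly N n w\<bar>)"
      by (rule integral_mult_right)
    also have "\<dots> \<le> fact n / fact N * (fact N * c)"
      using le by (rule mult_left_mono) simp
    finally show ?thesis by (simp add: c_def)
  qed
qed

subsection \<open>Poisson transforms and differences\<close>

lemma diffs_divide_fact: "diffs (\<lambda>m. A m / fact m) = (\<lambda>m. A (Suc m) / fact m :: real)"
  by (rule ext) (simp add: diffs_def field_simps del: of_nat_Suc)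

lemma summable_fdiff:
  assumes "\<And>x::real. summable (\<lambda>m. A m / fact m * x ^ m)"
  shows "summable (\<lambda>m. fdiff A m / fact m * x ^ m)"
proof -
  have "summable (\<lambda>m. diffs (\<lambda>m. A m / fact m) m * x ^ m)"
    by (rule termdiff_converges_all) (rule assms)
  then have "summable (\<lambda>m. A (Suc m) / fact m * x ^ m - A m / fact m * x ^ m)"
    unfolding diffs_divide_fact by (rule summable_diff) (rule assms)
  then show ?thesis
    by (simp add: fdiff_def diff_divide_distrib left_diff_distrib)
qed

lemma summable_fdiff_funpow:
  assumes "\<And>x::real. summable (\<lambda>m. A m / fact m * x ^ m)"
  shows "summable (\<lambda>m. (fdiff ^^ k) A m / fact m * x ^ m)"
proof (induction k arbitrary: x)
  case 0
  show ?case using assms by simp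
next
  case (Suc k)
  show ?case using summable_fdiff[OF Suc] by simp
qed

lemma has_real_derivative_poisson_transform:
  assumes "\<And>x::real. summable (\<lambda>m. A m / fact m * x ^ m)"
  shows "(poisson_transform A has_real_derivative poisson_transform (fdiff A) x) (at x)"
proof -
  have shift: "summable (\<lambda>m. A (Suc m) / fact m * x ^ m)"
    using termdiff_converges_all[OF assms] unfolding diffs_divide_fact .
  have "((\<lambda>x. \<Sum>m. A m / fact m * x ^ m) has_real_derivative (\<Sum>m. A (Suc m) / fact m * x ^ m)) (at x)"
    using termdiffs_strong_converges_everywhere[OF assms] unfolding diffs_divide_fact .
  then have "(poisson_transform A has_real_derivative
      exp (-x) * (\<Sum>m. A (Suc m) / fact m * x ^ m) - exp (-x) * (\<Sum>m. A m / fact m * x ^ m)) (at x)"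
    unfolding poisson_transform_def[abs_def] by (auto intro!: derivative_eq_intros)
  also have "(exp (-x) * (\<Sum>m. A (Suc m) / fact m * x ^ m) - exp (-x) * (\<Sum>m. A m / fact m * x ^ m))
      = poisson_transform (fdiff A) x"
    unfolding poisson_transform_def right_diff_distrib[symmetric] suminf_diff[OF shift assms]
    by (simp add: fdiff_def diff_divide_distrib left_diff_distrib)
  finally show ?thesis .
qed

lemma deriv_funpow_poisson_transform:
  assumes "\<And>x::real. summable (\<lambda>m. A m / fact m * x ^ m)"
  shows "(deriv ^^ k) (poisson_transform A) = poisson_transform ((fdiff ^^ k) A)"
proof (induction k)
  case (Suc k)
  have "deriv (poisson_transform ((fdiff ^^ k) A)) = poisson_transform (fdiff ((fdiff ^^ k) A))"
    by (intro ext DERIV_imp_deriv has_real_derivative_poisson_transform summable_fdiff_funpow assms)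
  then show ?case using Suc by simp
qed simp

lemma poisson_transform_0 [simp]: "poisson_transform A 0 = A 0"
  using powser_zero[of "\<lambda>m. A m / fact m"] by (simp add: poisson_transform_def)

lemma summable_abs_divide_fact:
  assumes "\<And>x::real. summable (\<lambda>m. A m / fact m * x ^ m)" and "r \<ge> 0"
  shows "summable (\<lambda>m. \<bar>A m\<bar> / fact m * r ^ m)"
proof -
  have "summable (\<lambda>m. norm (A m / fact m * r ^ m))"
    using assms(2) by (intro powser_insidea[OF assms(1)[of "r + 1"]]) simp
  then show ?thesis using assms(2) by (simp add: abs_mult)
qed

section \<open>Newton's formula at 0 and the derivative of the Charlier expansion\<close>

text \<open>By Pascal's rule (n-1-m choose N) = (n-m choose N+1) - (n-1-m choose N+1) for m < n, so
  this is Abel summation, with vanishing boundary term at m = n.\<close>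

lemma sum_choose_mult_summation_by_parts:
  "(\<Sum>m<n. real ((n - 1 - m) choose N) * b m)
     = real (n choose Suc N) * b 0 + (\<Sum>m<n. real ((n - 1 - m) choose Suc N) * fdiff b m)"
proof (induction n arbitrary: b)
  case (Suc n)
  show ?case
    using Suc[of "\<lambda>m. b (Suc m)"]
    unfolding sum.lessThan_Suc_shift by (simp add: fdiff_def algebra_simps)
qed simp

text \<open>Starting from the telescoping sum of first differences, each summation by parts splits
  off one more Newton term. As m < n, the subtraction \<open>n - 1 - m\<close> is never
  truncated.\<close>

lemma newton_forward_difference:
  "A n = (\<Sum>m\<le>N. real (n choose m) * (fdiff ^^ m) A 0)
     + (\<Sum>m<n. real ((n - 1 - m) choose N) * (fdiff ^^ Suc N) A m)"
proof (induction N)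
  case 0
  show ?case by (simp add: fdiff_def sum_lessThan_telescope)
next
  case (Suc N)
  show ?case
    using Suc sum_choose_mult_summation_by_parts[of n N "(fdiff ^^ Suc N) A"]
    by simp
qed

lemma has_real_derivative_charlier_expansion:
  assumes "\<And>x::real. summable (\<lambda>m. A m / fact m * x ^ m)"
  shows "((\<lambda>w. \<Sum>m\<le>N. poisson_transform ((fdiff ^^ m) A) w * charlier_poly n m w)
     has_real_derivative poisson_transform ((fdiff ^^ Suc N) A) w * charlier_poly n N w) (at w)"
proof (induction N)
  case 0
  have "charlier_poly n 0 = (\<lambda>w. 1)"
    by (simp add: charlier_poly_def[abs_def])
  then show ?case
    using has_real_derivative_poisson_transform[OF assms] by simp
next
  case (Suc N)
  have "(poisson_transform ((fdiff ^^ Suc N) A) has_real_derivative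
      poisson_transform ((fdiff ^^ Suc (Suc N)) A) w) (at w)"
    using has_real_derivative_poisson_transform[OF summable_fdiff_funpow[OF assms], of "Suc N"] by simp
  from DERIV_add[OF Suc DERIV_mult[OF this has_real_derivative_charlier_poly_Suc[of n N]]]
  show ?case by (simp add: algebra_simps)
qed

subsection \<open>The error of the Charlier expansion\<close>

text \<open>Separates the differences of \<open>A\<close>, entering only through their absolute
  series at \<open>R\<close>, from the polynomial, entering only through a weighted L1 norm that
  depends on n and N alone.\<close>

lemma charlier_expansion_error_le:
  fixes A :: "nat \<Rightarrow> real" and n N :: nat
  defines "a \<equiv> (fdiff ^^ Suc N) A"
  assumes conv: "\<And>x::real. summable (\<lambda>m. A m / fact m * x ^ m)" and "R > 0"
  shows "\<bar>A n - (\<Sum>m\<le>N. poisson_transform ((fdiff ^^ m) A) R * charlier_poly n m R)\<bar>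
    \<le> (\<Sum>m. \<bar>a m\<bar> / fact m * R ^ m) / R ^ n
        * integral {0..} (\<lambda>w. w ^ n * exp (-w) * \<bar>charlier_poly n N w\<bar>)"
proof -
  define g where "g = charlier_poly n N"
  define F where "F m w = w ^ m * exp (-w) * g w" for m and w :: real
  define B where "B w = w ^ n * exp (-w) * \<bar>g w\<bar>" for w :: real
  \<comment> \<open>The terms of index at least n stay together as one function, so that only a
    finite head is integrated term by term.\<close>
  define T where "T w = (\<Sum>m. a (m + n) / fact (m + n) * w ^ (m + n))" for w :: real
  define G where "G w = (\<Sum>m\<le>N. poisson_transform ((fdiff ^^ m) A) w * charlier_poly n m w)" for w
  define s1 where "s1 = (\<Sum>m<n. \<bar>a m\<bar> / fact m * R ^ m)"
  define s2 where "s2 = (\<Sum>m. \<bar>a (m + n)\<bar> / fact (m + n) * R ^ (m + n))"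
  have suma: "summable (\<lambda>m. a m / fact m * x ^ m)" for x :: real
    unfolding a_def by (rule summable_fdiff_funpow) (rule conv)
  note sumabs = summable_abs_divide_fact[of a, OF suma]
  have s: "(\<Sum>m. \<bar>a m\<bar> / fact m * R ^ m) = s2 + s1"
    unfolding s1_def s2_def using \<open>R > 0\<close> by (intro suminf_split_initial_segment sumabs) simp
  have sumtail: "summable (\<lambda>m. \<bar>a (m + n)\<bar> / fact (m + n) * R ^ (m + n))"
    using summable_ignore_initial_segment[OF sumabs[of R], of n] \<open>R > 0\<close> by simp
  have s_nonneg: "s1 \<ge> 0" "s2 \<ge> 0"
    unfolding s1_def s2_def using \<open>R > 0\<close>
    by (intro sum_nonneg suminf_nonneg[OF sumtail]; simp)+
  have F_int: "F m integrable_on X" if "X \<in> {{0..}, {0..R}, {R..}}" for m X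
  proof -
    have "F m absolutely_integrable_on {0..}"
      unfolding F_def[abs_def] g_def by (rule absolutely_integrable_moment_charlier_poly)
    then have "F m absolutely_integrable_on X"
      by (rule set_integrable_subset) (use that \<open>R > 0\<close> in auto)
    then show ?thesis by (rule set_lebesgue_integral_eq_integral)
  qed
  have B_int: "B integrable_on X" if "X \<in> {{0..}, {0..R}, {R..}}" for X
  proof -
    have "B absolutely_integrable_on {0..}"
      unfolding B_def[abs_def] g_def by (rule absolutely_integrable_moment_abs_charlier_poly)
    then have "B absolutely_integrable_on X"
      by (rule set_integrable_subset) (use that \<open>R > 0\<close> in auto)
    then show ?thesis by (rule set_lebesgue_integral_eq_integral)
  qed
  have split: "{0..} = {0..R} \<union> {R..}" "{0..R} \<inter> {R..} = {R}"
    using \<open>R > 0\<close> by auto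
  have negl: "negligible ({0..R} \<inter> {R..})"
    unfolding split(2) by simp
  have F_split: "integral {0..} (F m) = integral {0..R} (F m) + integral {R..} (F m)" for m
    unfolding split(1) by (rule integral_Un[OF F_int F_int negl]) simp_all
  have B_split: "integral {0..} B = integral {0..R} B + integral {R..} B"
    unfolding split(1) by (rule integral_Un[OF B_int B_int negl]) simp_all

  have FTC: "((\<lambda>w. poisson_transform a w * g w) has_integral G R - G 0) {0..R}"
  proof (rule fundamental_theorem_of_calculus)
    fix w
    show "(G has_vector_derivative poisson_transform a w * g w) (at w within {0..R})"
      using has_real_derivative_charlier_expansion[OF conv, where N = N and n = n]
      unfolding G_def[abs_def] a_def g_def
      by (simp add: has_real_derivative_iff_has_vector_derivative has_vector_derivative_at_within)
  qed (use \<open>R > 0\<close> in simp)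
  have pt: "poisson_transform a w * g w = (\<Sum>m<n. a m / fact m * F m w) + exp (-w) * T w * g w" for w
  proof -
    have "(\<Sum>m. a m / fact m * w ^ m) = T w + (\<Sum>m<n. a m / fact m * w ^ m)"
      unfolding T_def by (rule suminf_split_initial_segment[OF suma])
    then show ?thesis
      unfolding poisson_transform_def F_def
      by (simp add: distrib_left distrib_right sum_distrib_left sum_distrib_right mult_ac)
  qed
  have head: "((\<lambda>w. \<Sum>m<n. a m / fact m * F m w) has_integral
      (\<Sum>m<n. a m / fact m * integral {0..R} (F m))) {0..R}"
    by (intro has_integral_sum has_integral_mult_right integrable_integral F_int) auto
  \<comment> \<open>Integrability and value of the tail both come from subtracting the integrated
    head from the total.\<close>
  have tail: "((\<lambda>w. exp (-w) * T w * g w) has_integral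
      G R - G 0 - (\<Sum>m<n. a m / fact m * integral {0..R} (F m))) {0..R}"
    using has_integral_diff[OF FTC head] unfolding pt by simp

  have "A n - G 0 = (\<Sum>m<n. real ((n - 1 - m) choose N) * a m)"
    using newton_forward_difference[of A n N] unfolding G_def a_def by (simp add: mult_ac)
  also have "\<dots> = (\<Sum>m<n. a m / fact m * integral {0..} (F m))"
  proof (rule sum.cong)
    fix m assume m: "m \<in> {..<n}"
    then have "real n - real m - 1 = real (n - 1 - m)"
      by (simp add: of_nat_diff)
    then have "integral {0..} (F m) = fact m * real ((n - 1 - m) choose N)"
      using integral_unique[OF has_integral_moment_charlier_poly[of m n N]]
      unfolding F_def[abs_def] g_def by (simp add: binomial_gbinomial)
    then show "real ((n - 1 - m) choose N) * a m = a m / fact m * integral {0..} (F m)"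
      by simp
  qed simp
  \<comment> \<open>For m < n, removing [0,R] from the half-line leaves [R,infinity); the indices m
    >= n appear only in the subtracted bracket, which is the tail integral over [0,R].\<close>
  finally have "A n - G R = (\<Sum>m<n. a m / fact m * integral {R..} (F m))
      - (G R - G 0 - (\<Sum>m<n. a m / fact m * integral {0..R} (F m)))"
    by (simp add: F_split distrib_left sum.distrib)
  also have "\<bar>\<dots>\<bar> \<le> s1 / R ^ n * integral {R..} B + s2 / R ^ n * integral {0..R} B"
  proof (rule order_trans[OF abs_triangle_ineq4 add_mono])
    have "\<bar>\<Sum>m<n. a m / fact m * integral {R..} (F m)\<bar>
        \<le> (\<Sum>m<n. \<bar>a m\<bar> / fact m * (R ^ m / R ^ n * integral {R..} B))"
    proof (rule order_trans[OF sum_abs sum_mono])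
      fix m assume "m \<in> {..<n}"
      then have m: "m < n" by simp
      have "norm (integral {R..} (F m)) \<le> integral {R..} (\<lambda>w. R ^ m / R ^ n * B w)"
      proof (rule integral_norm_bound_integral)
        show "F m integrable_on {R..}" by (rule F_int) simp
        show "(\<lambda>w. R ^ m / R ^ n * B w) integrable_on {R..}"
          using B_int[of "{R..}"] by (intro integrable_on_mult_right) simp
        fix w assume "w \<in> {R..}"
        then have w: "R \<le> w" by simp
        \<comment> \<open>The target is w^m <= R^(m-n) w^n, proved in multiplied form because m - n
          is negative.\<close>
        have "R ^ (n - m) \<le> w ^ (n - m)" using w \<open>R > 0\<close> by (intro power_mono) auto
        then have "w ^ m * R ^ m * R ^ (n - m) \<le> w ^ m * R ^ m * w ^ (n - m)"
          using w \<open>R > 0\<close> by (intro mult_left_mono) auto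
        also have "w ^ m * R ^ m * R ^ (n - m) = w ^ m * R ^ n"
          using m by (simp add: power_add[symmetric] mult.assoc)
        also have "w ^ m * R ^ m * w ^ (n - m) = R ^ m * w ^ n"
          using m by (metis (no_types) le_add_diff_inverse less_imp_le mult.assoc mult.commute power_add)
        finally have "w ^ m \<le> R ^ m / R ^ n * w ^ n"
          using \<open>R > 0\<close> by (simp add: field_simps)
        then have "w ^ m * (exp (-w) * \<bar>g w\<bar>) \<le> R ^ m / R ^ n * w ^ n * (exp (-w) * \<bar>g w\<bar>)"
          by (rule mult_right_mono) simp
        then show "norm (F m w) \<le> R ^ m / R ^ n * B w"
          using w \<open>R > 0\<close> by (simp add: F_def B_def abs_mult mult_ac)
      qed
      then have "\<bar>integral {R..} (F m)\<bar> \<le> R ^ m / R ^ n * integral {R..} B"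
        by simp
      then have "\<bar>a m\<bar> / fact m * \<bar>integral {R..} (F m)\<bar>
          \<le> \<bar>a m\<bar> / fact m * (R ^ m / R ^ n * integral {R..} B)"
        by (rule mult_left_mono) simp
      then show "\<bar>a m / fact m * integral {R..} (F m)\<bar> \<le> \<bar>a m\<bar> / fact m * (R ^ m / R ^ n * integral {R..} B)"
        by (simp add: abs_mult)
    qed
    also have "\<dots> = s1 / R ^ n * integral {R..} B"
      unfolding s1_def by (simp add: sum_distrib_right sum_divide_distrib mult.assoc)
    finally show "\<bar>\<Sum>m<n. a m / fact m * integral {R..} (F m)\<bar> \<le> s1 / R ^ n * integral {R..} B" .
  next
    have "norm (integral {0..R} (\<lambda>w. exp (-w) * T w * g w)) \<le> integral {0..R} (\<lambda>w. s2 / R ^ n * B w)"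
    proof (rule integral_norm_bound_integral)
      show "(\<lambda>w. exp (-w) * T w * g w) integrable_on {0..R}" using tail by blast
      show "(\<lambda>w. s2 / R ^ n * B w) integrable_on {0..R}"
        using B_int[of "{0..R}"] by (intro integrable_on_mult_right) simp
      fix w assume "w \<in> {0..R}"
      then have w: "0 \<le> w" "w \<le> R" by auto
      have "norm (T w) \<le> (\<Sum>m. w ^ n / R ^ n * (\<bar>a (m + n)\<bar> / fact (m + n) * R ^ (m + n)))"
        unfolding T_def
      proof (rule norm_suminf_le)
        fix m
        \<comment> \<open>Only the factor w^m is enlarged to R^m; w^n is kept for the weight
          \<open>B\<close>.\<close>
        have "w ^ (m + n) \<le> w ^ n / R ^ n * R ^ (m + n)"
          using w \<open>R > 0\<close> power_mono[OF w(2,1), of m] by (simp add: power_add mult_right_mono mult.commute)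
        then have "\<bar>a (m + n)\<bar> / fact (m + n) * w ^ (m + n)
            \<le> \<bar>a (m + n)\<bar> / fact (m + n) * (w ^ n / R ^ n * R ^ (m + n))"
          by (rule mult_left_mono) simp
        then show "norm (a (m + n) / fact (m + n) * w ^ (m + n))
            \<le> w ^ n / R ^ n * (\<bar>a (m + n)\<bar> / fact (m + n) * R ^ (m + n))"
          using w by (simp add: abs_mult mult_ac)
      qed (rule summable_mult[OF sumtail])
      also have "\<dots> = w ^ n / R ^ n * s2"
        unfolding s2_def by (rule suminf_mult[OF sumtail])
      finally have "norm (T w) * (exp (-w) * \<bar>g w\<bar>) \<le> w ^ n / R ^ n * s2 * (exp (-w) * \<bar>g w\<bar>)"
        by (rule mult_right_mono) simp
      then show "norm (exp (-w) * T w * g w) \<le> s2 / R ^ n * B w"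
        by (simp add: B_def abs_mult mult_ac)
    qed
    then show "\<bar>G R - G 0 - (\<Sum>m<n. a m / fact m * integral {0..R} (F m))\<bar> \<le> s2 / R ^ n * integral {0..R} B"
      by (simp add: integral_unique[OF tail])
  qed
  \<comment> \<open>Both coefficients are raised to their common total, so that the two ranges
    recombine into the half-line.\<close>
  also have "\<dots> \<le> (s2 + s1) / R ^ n * integral {0..} B"
  proof -
    have B_nonneg: "0 \<le> integral {0..R} B" "0 \<le> integral {R..} B"
      using \<open>R > 0\<close> by (auto intro!: integral_nonneg B_int simp: B_def)
    have le: "s1 / R ^ n \<le> (s2 + s1) / R ^ n" "s2 / R ^ n \<le> (s2 + s1) / R ^ n"
      using s_nonneg \<open>R > 0\<close> by (simp_all add: divide_right_mono)
    have "s1 / R ^ n * integral {R..} B \<le> (s2 + s1) / R ^ n * integral {R..} B"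
      "s2 / R ^ n * integral {0..R} B \<le> (s2 + s1) / R ^ n * integral {0..R} B"
      by (rule mult_right_mono[OF le(1) B_nonneg(2)], rule mult_right_mono[OF le(2) B_nonneg(1)])
    then show ?thesis unfolding B_split by (simp add: distrib_left)
  qed
  finally show ?thesis
    unfolding s G_def B_def[abs_def] g_def .
qed

theorem theorem9:
  fixes A :: "nat \<Rightarrow> real" and f :: "real \<Rightarrow> real" and R :: real and n N :: nat
  assumes conv: "\<And>x::real. summable (\<lambda>m. A m / fact m * x ^ m)"
    and f_def: "f = poisson_transform A"
    and "R > 0" and "n \<ge> 2"
  shows "\<bar>A n - (\<Sum>m=0..N. (deriv ^^ m) f R / fact m * R ^ m * charlier m R n)\<bar>
    \<le> 6 * fact n * (exp R * E_deriv A (N + 1) R / R ^ n) * real n powr (real N / 2)"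
proof -
  define s where "s = (\<Sum>m. \<bar>(fdiff ^^ Suc N) A m\<bar> / fact m * R ^ m)"
  have s: "exp R * E_deriv A (N + 1) R = s"
    unfolding s_def E_deriv_def by (simp add: exp_minus)
  have "s \<ge> 0"
    unfolding s_def using \<open>R > 0\<close>
    by (intro suminf_nonneg summable_abs_divide_fact summable_fdiff_funpow conv) auto
  have "(deriv ^^ m) f R / fact m * R ^ m * charlier m R n
      = poisson_transform ((fdiff ^^ m) A) R * charlier_poly n m R" for m
    unfolding f_def deriv_funpow_poisson_transform[OF conv]
      charlier_conv_charlier_poly[OF \<open>R > 0\<close>, symmetric] by simp
  then have "\<bar>A n - (\<Sum>m=0..N. (deriv ^^ m) f R / fact m * R ^ m * charlier m R n)\<bar>
      \<le> s / R ^ n * integral {0..} (\<lambda>w. w ^ n * exp (-w) * \<bar>charlier_poly n N w\<bar>)"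
    using charlier_expansion_error_le[OF conv \<open>R > 0\<close>, of n N] by (simp add: s_def atLeast0AtMost)
  also have "\<dots> \<le> s / R ^ n * (fact n * (6 * real n powr (real N / 2)))"
    using integral_abs_charlier_poly_le[OF \<open>n \<ge> 2\<close>] \<open>s \<ge> 0\<close> \<open>R > 0\<close>
    by (intro mult_left_mono) auto
  finally show ?thesis unfolding s by (simp add: mult_ac)
qed

end
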